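(* Let $\tilde\theta_0\in\tilde\Theta$ and let $\{\mathbf{X}(k)\}_{k\ge0}$ be the generic BAR process with true parameter $\tilde\theta_0$ and an arbitrary initial distribution $P_{\mathbf{X}(0)}$ on $\{0,1\}^p$ that does not depend on the parameter. For each $T\ge1$ let $\tilde\theta_T$ be a maximum likelihood estimator based on $\mathbf{X}(0),\dots,\mathbf{X}(T)$, i.e. $\tilde\theta_T\in\arg\max_{\tilde\theta\in\tilde\Theta}\tilde L_T(\tilde\theta)$. Then $\tilde\theta_T$ is strongly consistent: $\tilde\theta_T\to\tilde\theta_0$ almost surely as $T\to\infty$.
   Context: Fix $p\in\mathbb{N}$, $p\ge 1$, and constants $b_{min}\in(0,1)$ and $0<\rho_{min}<\rho_{max}<1$. Let $\mathbf{1}$ be the all-ones vector in $\mathbb{R}^p$. Parameter space: $\tilde\Theta$ is the set of $\tilde\theta=(\mathbf{A},\tilde{\mathbf{A}},\mathbf{b},\rho_w)$ with $\mathbf{A}=(a_{ij}),\tilde{\mathbf{A}}=(\tilde a_{ij})\in\mathbb{R}^{p\times p}$, $\mathbf{b},\rho_w\in\mathbb{R}^p$ such that for all $i,j\in\{1,\dots,p\}$: $\sum_{j=1}^p(a_{ij}+\tilde a_{ij})+b_i=1$, $b_i\ge b_{min}$, $\rho_{w_i}\in[\rho_{min},\rho_{max}]$, $a_{ij}\ge 0$, $\tilde a_{ij}\ge0$, and $a_{ij}\tilde a_{ij}=0$. The $i$-th rows of $\mathbf{A}$ and $\tilde{\mathbf{A}}$ are denoted $\mathbf{a}_i^\top$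 and $\tilde{\mathbf{a}}_i^\top$. Generic BAR model with parameter $\tilde\theta\in\tilde\Theta$: a Markov chain $\{\mathbf{X}(k)\}_{k\ge0}$ on $\{0,1\}^p$ with $\mathbf{X}(0)\sim P_{\mathbf{X}(0)}$ and $$X_i(k+1)\sim\mathrm{Ber}\left(\mathbf{a}_i^\top\mathbf{X}(k)+\tilde{\mathbf{a}}_i^\top(\mathbf{1}-\mathbf{X}(k))+b_iW_i(k+1)\right),\quad i=1,\dots,p,$$ where $W_i(k+1)\sim\mathrm{Ber}(\rho_{w_i})$, $i=1,\dots,p$, are independent noise variables, independent of $\mathbf{X}(t)$ for all $t<k+1$, and the entries of $\mathbf{X}(k+1)$ are conditionally independent given $\mathbf{X}(k)$ (so, given $\mathbf{X}(k)=\mathbf{u}$, $X_i(k+1)$ is Bernoulli with parameter $\mathbf{a}_i^\top\mathbf{u}+\tilde{\mathbf{a}}_i^\top(\mathbf{1}-\mathbf{u})+\rho_{w_i}b_i$). Rescaled log-likelihood of observations $\mathbf{x}(0),\dots,\mathbf{x}(T)$: $$\tilde L_T(\tilde\theta)=\frac1T\sum_{k=0}^{T-1}\sum_{i=1}^p\Big[x_i(k+1)\log q_i(\mathbf{x}(k))+(1-x_i(k+1))\log(1-q_i(\mathbf{x}(k)))\Big]+\frac1T\log P_{\mathbf{X}(0)}(\mathbf{x}(0)),$$ where $q_i(\mathbf{u})=\mathbf{a}_i^\top\mathbf{u}+\tilde{\mathbf{a}}_i^\top(\mathbf{1}-\mathbf{u})+\rho_{w_i}b_i$. *)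

theory Defs
  imports "HOL-Probability.Probability"
begin

text \<open>The state space \<open>{0,1}\<^sup>p\<close>, as a subset of \<open>\<real>\<^sup>p\<close>; the dimension \<open>p \<ge> 1\<close> is
  \<open>CARD('p)\<close>, and \<open>1 :: real ^ 'p\<close> is the all-ones vector.\<close>

definition binary_cube :: "(real ^ 'p) set" where
  "binary_cube = {u. \<forall>i. u $ i \<in> {0, 1}}"

text \<open>A parameter is a tuple \<open>(A, A', b, \<rho>)\<close>, where \<open>A'\<close> stands for the matrix written with a
  tilde. The \<open>i\<close>-th row of \<open>A\<close> is \<open>A $ i\<close>.\<close>

type_synonym 'p bar_param =
  "(real ^ 'p ^ 'p) \<times> (real ^ 'p ^ 'p) \<times> (real ^ 'p) \<times> (real ^ 'p)"

definition param_space :: "real \<Rightarrow> real \<Rightarrow> real \<Rightarrow> 'p::finite bar_param set" where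
  "param_space bmin \<rho>min \<rho>max = {(A, A', b, \<rho>).
     (\<forall>i. (\<Sum>j\<in>UNIV. A $ i $ j + A' $ i $ j) + b $ i = 1 \<and> b $ i \<ge> bmin \<and> \<rho> $ i \<in> {\<rho>min..\<rho>max}) \<and>
     (\<forall>i j. A $ i $ j \<ge> 0 \<and> A' $ i $ j \<ge> 0 \<and> A $ i $ j * A' $ i $ j = 0)}"

definition markov_chain :: "'a measure \<Rightarrow> 's set \<Rightarrow> (nat \<Rightarrow> 'a \<Rightarrow> 's) \<Rightarrow> bool" where
  "markov_chain M S X \<longleftrightarrow>
     (\<forall>k. X k \<in> measurable M (count_space S)) \<and>
     (\<forall>k x. \<P>(\<omega> in M. \<forall>t\<le>k. X t \<omega> = x t) > 0 \<longrightarrow>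
        \<P>(\<omega> in M. X (Suc k) \<omega> = x (Suc k) \<bar> \<forall>t\<le>k. X t \<omega> = x t) =
        \<P>(\<omega> in M. X (Suc k) \<omega> = x (Suc k) \<bar> X k \<omega> = x k))"

text \<open>The generic BAR model. The noise is \<open>W 1, W 2, \<dots>\<close>; \<open>W 0\<close> is not used. As all coordinates
  take values in \<open>{0,1}\<close>, a Bernoulli law is specified by the probability of the value \<open>1\<close>. The law
  with the random parameter containing \<open>X k\<close> and \<open>W (Suc k) $ i\<close> is the conditional law
  given these two variables.\<close>

fun generic_BAR :: "'a measure \<Rightarrow> (real ^ 'p) pmf \<Rightarrow> 'p::finite bar_param \<Rightarrow>
    (nat \<Rightarrow> 'a \<Rightarrow> real ^ 'p) \<Rightarrow> (nat \<Rightarrow> 'a \<Rightarrow> real ^ 'p) \<Rightarrow> bool" where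
  "generic_BAR M P0 (A, A', b, \<rho>) X W \<longleftrightarrow>
     markov_chain M binary_cube X \<and>
     (\<forall>u\<in>binary_cube. \<P>(\<omega> in M. X 0 \<omega> = u) = pmf P0 u) \<and>
     \<comment> \<open>noise\<close>
     (\<forall>k. W (Suc k) \<in> measurable M (count_space binary_cube)) \<and>
     (\<forall>k i. \<P>(\<omega> in M. W (Suc k) \<omega> $ i = 1) = \<rho> $ i) \<and>
     (\<forall>k. prob_space.indep_vars M (\<lambda>_. borel) (\<lambda>i \<omega>. W (Suc k) \<omega> $ i) UNIV) \<and>
     (\<forall>k. \<forall>t<Suc k. prob_space.indep_var M
        (count_space binary_cube) (W (Suc k)) (count_space binary_cube) (X t)) \<and>
     \<comment> \<open>law of each entry\<close>
     (\<forall>k i u w. \<P>(\<omega> in M. X k \<omega> = u \<and> W (Suc k) \<omega> $ i = w) > 0 \<longrightarrow>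
        \<P>(\<omega> in M. X (Suc k) \<omega> $ i = 1 \<bar> X k \<omega> = u \<and> W (Suc k) \<omega> $ i = w) =
        A $ i \<bullet> u + A' $ i \<bullet> (1 - u) + b $ i * w) \<and>
     \<comment> \<open>conditional independence of the entries\<close>
     (\<forall>k u v. \<P>(\<omega> in M. X k \<omega> = u) > 0 \<longrightarrow>
        \<P>(\<omega> in M. X (Suc k) \<omega> = v \<bar> X k \<omega> = u) =
        (\<Prod>i\<in>UNIV. \<P>(\<omega> in M. X (Suc k) \<omega> $ i = v $ i \<bar> X k \<omega> = u)))"

fun success_prob :: "'p::finite bar_param \<Rightarrow> 'p \<Rightarrow> real ^ 'p \<Rightarrow> real" where
  "success_prob (A, A', b, \<rho>) i u = A $ i \<bullet> u + A' $ i \<bullet> (1 - u) + \<rho> $ i * b $ i"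

text \<open>The rescaled log-likelihood of \<open>x 0, \<dots>, x T\<close>. Since \<open>ln 0 = 0\<close> here, it has the intended value
  only if \<open>P0\<close> charges \<open>x 0\<close>, which holds almost surely for the observed process.\<close>

definition log_likelihood ::
  "(real ^ 'p) pmf \<Rightarrow> nat \<Rightarrow> (nat \<Rightarrow> real ^ 'p) \<Rightarrow> 'p::finite bar_param \<Rightarrow> real" where
  "log_likelihood P0 T x \<theta> =
     1 / real T * (\<Sum>k<T. \<Sum>i\<in>UNIV.
        x (Suc k) $ i * ln (success_prob \<theta> i (x k)) +
        (1 - x (Suc k) $ i) * ln (1 - success_prob \<theta> i (x k)))
     + 1 / real T * ln (pmf P0 (x 0))"

end

theory Submission
  imports Defs "HOL-Library.Discrete_Functions"
begin

text \<open>For a state \<open>u\<close> and an event \<open>B\<close> of conditional probability \<open>\<pi>\<close> given \<open>X k = u\<close>, the variables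
  \<open>1{X k = u} (1{X (k+1) \<in> B} - \<pi>)\<close> are bounded and uncorrelated by the Markov property, so their
  averages vanish almost surely; no ergodic theorem is needed. Applied to \<open>B = {v}\<close>, together with a
  uniform lower bound on the transition probabilities, this shows that every state is visited with
  positive lower frequency; applied to \<open>B = {v. v\<^sub>i = 1}\<close>, it controls the score. The rest is pathwise:
  up to an error tending to \<open>0\<close>, the log-likelihood at \<open>\<theta>\<close> minus the one at \<open>\<theta>0\<close> is a negative
  combination of Kullback-Leibler divergences between Bernoulli laws, with weights the visit
  frequencies. As it is nonnegative at a maximiser, all success probabilities converge, and the
  parameter is a continuous function of them.\<close>

lemma finite_binary_cube: "finite (binary_cube :: (real ^ 'p::finite) set)"
proof (rule finite_subset)
  show "(binary_cube :: (real ^ 'p) set) \<subseteq> vec_lambda ` (UNIV \<rightarrow>\<^sub>E {0, 1})"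
  proof
    fix u :: "real ^ 'p" assume "u \<in> binary_cube"
    then have "vec_nth u \<in> UNIV \<rightarrow>\<^sub>E {0, 1}" "u = vec_lambda (vec_nth u)"
      by (auto simp: binary_cube_def PiE_def Pi_def)
    then show "u \<in> vec_lambda ` (UNIV \<rightarrow>\<^sub>E {0, 1})" by blast
  qed
qed (auto intro!: finite_imageI finite_PiE)

section \<open>Laws of large numbers\<close>

text \<open>The sum of all \<open>Y n\<close> has finite expectation, hence is finite almost surely,
  and the terms of a convergent series vanish. This takes the place of Chebyshev's inequality with
  Borel-Cantelli.\<close>

lemma AE_tendsto_0_of_summable_expectation:
  fixes Y :: "nat \<Rightarrow> 'a \<Rightarrow> real"
  assumes int: "\<And>n. integrable M (Y n)" and nn: "\<And>n \<omega>. 0 \<le> Y n \<omega>"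
    and le: "\<And>n. integral\<^sup>L M (Y n) \<le> e n" and e: "summable e"
  shows "AE \<omega> in M. (\<lambda>n. Y n \<omega>) \<longlonglongrightarrow> 0"
proof -
  have [measurable]: "Y n \<in> borel_measurable M" for n
    using int by auto
  have e0: "0 \<le> e n" for n
    by (rule order_trans[OF Bochner_Integration.integral_nonneg le]) (rule nn)
  have "(\<integral>\<^sup>+\<omega>. (\<Sum>n. ennreal (Y n \<omega>)) \<partial>M) = (\<Sum>n. \<integral>\<^sup>+\<omega>. ennreal (Y n \<omega>) \<partial>M)"
    by (rule nn_integral_suminf) simp
  also have "\<dots> = (\<Sum>n. ennreal (integral\<^sup>L M (Y n)))"
    using int nn by (simp add: nn_integral_eq_integral)
  also have "\<dots> \<le> (\<Sum>n. ennreal (e n))"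
    by (intro suminf_le summableI ennreal_leI le)
  also have "\<dots> = ennreal (suminf e)"
    using e e0 by (simp add: suminf_ennreal2)
  also have "\<dots> < \<infinity>" by simp
  finally have "(\<integral>\<^sup>+\<omega>. (\<Sum>n. ennreal (Y n \<omega>)) \<partial>M) \<noteq> \<infinity>"
    by simp
  then have "AE \<omega> in M. (\<Sum>n. ennreal (Y n \<omega>)) \<noteq> \<infinity>"
    by (intro nn_integral_PInf_AE) auto
  then show ?thesis
  proof eventually_elim
    case (elim \<omega>)
    then have "summable (\<lambda>n. Y n \<omega>)"
      using nn by (intro summable_suminf_not_top) (auto simp: top_ennreal_def)
    then show ?case by (rule summable_LIMSEQ_zero)
  qed
qed

text \<open>With \<open>m\<close> the integer square root of \<open>n\<close>, at most
  \<open>2 * m\<close> indices lie from \<open>m\<^sup>2\<close> up to \<open>n\<close>; as their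
  terms have modulus at most 1, they add at most \<open>2 / m\<close> to the bound on the
  average.\<close>

lemma averages_tendsto_0_of_squares:
  fixes d :: "nat \<Rightarrow> real"
  assumes bnd: "\<And>k. \<bar>d k\<bar> \<le> 1"
    and sq: "(\<lambda>m. (\<Sum>k<m\<^sup>2. d k) / real (m\<^sup>2)) \<longlonglongrightarrow> 0"
  shows "(\<lambda>n. (\<Sum>k<n. d k) / real n) \<longlonglongrightarrow> 0"
proof -
  let ?b = "\<lambda>m. \<bar>(\<Sum>k<m\<^sup>2. d k) / real (m\<^sup>2)\<bar> + 2 / real m"
  have b: "?b \<longlonglongrightarrow> 0"
    using tendsto_add[OF tendsto_rabs[OF sq] tendsto_divide_0[OF tendsto_const[of "2::real"]
      filterlim_compose[OF filterlim_real_at_infinity_sequentially filterlim_ident]]]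
    by simp
  have fs: "filterlim floor_sqrt at_top sequentially"
    unfolding filterlim_at_top
    by (auto simp: eventually_sequentially intro!: exI[of _ "_ ^ 2"] le_floor_sqrtI)
  have bs: "(\<lambda>n. ?b (floor_sqrt n)) \<longlonglongrightarrow> 0"
    by (rule filterlim_compose[OF b fs])
  have main: "norm ((\<Sum>k<n. d k) / real n) \<le> ?b (floor_sqrt n)" if n: "n \<ge> 1" for n
  proof -
    define m where "m = floor_sqrt n"
    have m1: "m \<ge> 1" unfolding m_def by (rule le_floor_sqrtI) (use n in auto)
    have mn: "m\<^sup>2 \<le> n" unfolding m_def by (rule floor_sqrt_power2_le)
    have "n < (Suc m)\<^sup>2" unfolding m_def by (rule Suc_floor_sqrt_power2_gt)
    then have nm: "n - m\<^sup>2 \<le> 2 * m" by (simp add: power2_eq_square)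
    have "(\<Sum>k<n. d k) = (\<Sum>k<m\<^sup>2. d k) + (\<Sum>k\<in>{m\<^sup>2..<n}. d k)"
      using mn by (metis atLeast0LessThan le0 sum.atLeastLessThan_concat)
    moreover have "\<bar>\<Sum>k\<in>{m\<^sup>2..<n}. d k\<bar> \<le> 2 * real m"
    proof -
      have "\<bar>\<Sum>k\<in>{m\<^sup>2..<n}. d k\<bar> \<le> (\<Sum>k\<in>{m\<^sup>2..<n}. \<bar>d k\<bar>)" by (rule sum_abs)
      also have "\<dots> \<le> (\<Sum>k\<in>{m\<^sup>2..<n}. 1)" by (intro sum_mono bnd)
      also have "\<dots> \<le> 2 * real m" using nm by simp
      finally show ?thesis .
    qed
    ultimately have "\<bar>\<Sum>k<n. d k\<bar> \<le> \<bar>\<Sum>k<m\<^sup>2. d k\<bar> + 2 * real m" by linarith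
    then have "\<bar>\<Sum>k<n. d k\<bar> / real n \<le> (\<bar>\<Sum>k<m\<^sup>2. d k\<bar> + 2 * real m) / real (m\<^sup>2)"
      using mn m1 by (intro frac_le) (auto simp flip: of_nat_power)
    also have "\<dots> = ?b m"
      using m1 by (simp add: add_divide_distrib power2_eq_square)
    finally show ?thesis using n by (simp add: m_def)
  qed
  show ?thesis
    by (rule Lim_null_comparison[OF _ bs]) (use main in \<open>auto simp: eventually_sequentially\<close>)
qed

text \<open>Orthogonality makes the second moment of the partial sums grow at most linearly, so the
  averages along squares have second moments at most \<open>1 / m^2\<close>, which is summable.
  Boundedness fills the gaps between squares.\<close>

lemma (in prob_space) slln_bounded_uncorrelated:
  fixes D :: "nat \<Rightarrow> 'a \<Rightarrow> real"
  assumes meas[measurable]: "\<And>k. random_variable borel (D k)"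
    and bnd: "\<And>k \<omega>. \<omega> \<in> space M \<Longrightarrow> \<bar>D k \<omega>\<bar> \<le> 1"
    and unc: "\<And>j k. j < k \<Longrightarrow> expectation (\<lambda>\<omega>. D j \<omega> * D k \<omega>) = 0"
  shows "AE \<omega> in M. (\<lambda>n. (\<Sum>k<n. D k \<omega>) / real n) \<longlonglongrightarrow> 0"
proof -
  let ?S = "\<lambda>n \<omega>. \<Sum>k<n. D k \<omega>"
  have DD: "integrable M (\<lambda>\<omega>. D j \<omega> * D k \<omega>)" for j k
  proof (rule integrable_const_bound[of _ 1])
    show "AE \<omega> in M. norm (D j \<omega> * D k \<omega>) \<le> 1"
      using bnd by (auto simp: abs_mult intro!: AE_I2 mult_le_one)
  qed simp
  have SD: "integrable M (\<lambda>\<omega>. ?S n \<omega> * D k \<omega>)" for n k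
    unfolding sum_distrib_right by (intro Bochner_Integration.integrable_sum DD)
  have SS: "integrable M (\<lambda>\<omega>. (?S n \<omega>)\<^sup>2)" for n
    unfolding power2_eq_square sum_product by (intro Bochner_Integration.integrable_sum DD)
  have var: "expectation (\<lambda>\<omega>. (?S n \<omega>)\<^sup>2) \<le> real n" for n
  proof (induction n)
    case (Suc n)
    have "expectation (\<lambda>\<omega>. ?S n \<omega> * D n \<omega>) = (\<Sum>j<n. expectation (\<lambda>\<omega>. D j \<omega> * D n \<omega>))"
      unfolding sum_distrib_right by (rule Bochner_Integration.integral_sum) (rule DD)
    also have "\<dots> = 0" using unc by simp
    finally have z: "expectation (\<lambda>\<omega>. ?S n \<omega> * D n \<omega>) = 0" .
    have "expectation (\<lambda>\<omega>. D n \<omega> * D n \<omega>) \<le> expectation (\<lambda>\<omega>. 1)"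
    proof (rule integral_mono[OF DD])
      fix \<omega> assume "\<omega> \<in> space M"
      from bnd[OF this, of n] have "\<bar>D n \<omega>\<bar> * \<bar>D n \<omega>\<bar> \<le> 1" by (intro mult_le_one) auto
      then show "D n \<omega> * D n \<omega> \<le> 1" by (simp flip: abs_mult)
    qed simp
    then have o: "expectation (\<lambda>\<omega>. D n \<omega> * D n \<omega>) \<le> 1" by (simp add: prob_space)
    have "(?S (Suc n) \<omega>)\<^sup>2 = (?S n \<omega>)\<^sup>2 + 2 * (?S n \<omega> * D n \<omega>) + D n \<omega> * D n \<omega>" for \<omega>
      by (simp add: power2_eq_square algebra_simps)
    then have "expectation (\<lambda>\<omega>. (?S (Suc n) \<omega>)\<^sup>2)
      = expectation (\<lambda>\<omega>. (?S n \<omega>)\<^sup>2) + 2 * expectation (\<lambda>\<omega>. ?S n \<omega> * D n \<omega>)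
        + expectation (\<lambda>\<omega>. D n \<omega> * D n \<omega>)"
      using SS SD DD by simp
    with z o Suc show ?case by simp
  qed simp
  \<comment> \<open>along squares the variances of the averages are summable\<close>
  have "AE \<omega> in M. (\<lambda>m. (?S (m\<^sup>2) \<omega> / real (m\<^sup>2))\<^sup>2) \<longlonglongrightarrow> 0"
  proof (rule AE_tendsto_0_of_summable_expectation)
    show "integrable M (\<lambda>\<omega>. (?S (m\<^sup>2) \<omega> / real (m\<^sup>2))\<^sup>2)" for m
      unfolding power_divide by (intro integrable_divide SS)
    \<comment> \<open>At \<open>m = 0\<close> both sides are 0, since division by 0 gives 0.\<close>
    show "expectation (\<lambda>\<omega>. (?S (m\<^sup>2) \<omega> / real (m\<^sup>2))\<^sup>2) \<le> inverse (real m ^ 2)" for m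
    proof -
      have "expectation (\<lambda>\<omega>. (?S (m\<^sup>2) \<omega> / real (m\<^sup>2))\<^sup>2)
        = expectation (\<lambda>\<omega>. (?S (m\<^sup>2) \<omega>)\<^sup>2) / (real (m\<^sup>2))\<^sup>2"
        unfolding power_divide by (rule integral_divide_zero)
      also have "\<dots> \<le> real (m\<^sup>2) / (real (m\<^sup>2))\<^sup>2"
        by (intro divide_right_mono var) simp
      also have "\<dots> = inverse (real m ^ 2)"
        by (simp add: power2_eq_square field_simps)
      finally show ?thesis .
    qed
    show "summable (\<lambda>m. inverse (real m ^ 2))"
      by (rule inverse_power_summable) simp
  qed simp
  then show ?thesis
    using AE_space
  proof eventually_elim
    case (elim \<omega>)
    then have "(\<lambda>m. sqrt ((?S (m\<^sup>2) \<omega> / real (m\<^sup>2))\<^sup>2)) \<longlonglongrightarrow> sqrt 0"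
      by (intro tendsto_real_sqrt)
    then have "(\<lambda>m. \<bar>?S (m\<^sup>2) \<omega> / real (m\<^sup>2)\<bar>) \<longlonglongrightarrow> 0"
      by (simp only: real_sqrt_abs real_sqrt_zero)
    then have "(\<lambda>m. ?S (m\<^sup>2) \<omega> / real (m\<^sup>2)) \<longlonglongrightarrow> 0"
      by (rule tendsto_rabs_zero_cancel)
    then show ?case
      using bnd elim by (intro averages_tendsto_0_of_squares) auto
  qed
qed

section \<open>Transition frequencies of a finite Markov chain\<close>

text \<open>The property in \<open>markov_chain\<close> concerns single successor states; summing
  over the states in \<open>B\<close> extends it to events. The product form, unlike a conditional
  probability, also covers histories of probability 0.\<close>

lemma (in prob_space) markov_chain_prob_history:
  assumes S: "finite S" and mc: "markov_chain M S X" and hk: "h k = u"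
    and step: "\<P>(\<omega> in M. X k \<omega> = u \<and> B (X (Suc k) \<omega>)) = \<pi> * \<P>(\<omega> in M. X k \<omega> = u)"
  shows "\<P>(\<omega> in M. (\<forall>t\<le>k. X t \<omega> = h t) \<and> B (X (Suc k) \<omega>))
    = \<pi> * \<P>(\<omega> in M. \<forall>t\<le>k. X t \<omega> = h t)"
proof -
  have [measurable]: "X k \<in> measurable M (count_space S)" for k
    using mc by (simp add: markov_chain_def)
  have XS: "X k \<omega> \<in> S" if "\<omega> \<in> space M" for k \<omega>
    using measurable_space[OF _ that, of "X k" "count_space S"] by simp
  let ?H = "\<lambda>\<omega>. \<forall>t\<le>k. X t \<omega> = h t"
  have [measurable]: "Measurable.pred M (\<lambda>\<omega>. X k \<omega> = v)" for k v
  proof -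
    have "Measurable.pred (count_space S) (\<lambda>x. x = v)" by simp
    then show ?thesis by measurable
  qed
  have split: "\<P>(\<omega> in M. P \<omega> \<and> B (X (Suc k) \<omega>))
      = (\<Sum>v\<in>{v\<in>S. B v}. \<P>(\<omega> in M. P \<omega> \<and> X (Suc k) \<omega> = v))"
    if [measurable]: "Measurable.pred M P" for P
  proof -
    have "{\<omega> \<in> space M. P \<omega> \<and> B (X (Suc k) \<omega>)}
        = (\<Union>v\<in>{v\<in>S. B v}. {\<omega> \<in> space M. P \<omega> \<and> X (Suc k) \<omega> = v})"
      using XS by auto
    then show ?thesis
      using S by (simp only:) (rule finite_measure_finite_Union,
        auto simp: disjoint_family_on_def)
  qed
  show ?thesis
  proof (cases "\<P>(\<omega> in M. ?H \<omega>) > 0")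
    case True
    have "\<P>(\<omega> in M. ?H \<omega>) \<le> \<P>(\<omega> in M. X k \<omega> = u)"
      using hk by (intro finite_measure_mono) auto
    with True have pu: "\<P>(\<omega> in M. X k \<omega> = u) > 0" by linarith
    have one: "\<P>(\<omega> in M. ?H \<omega> \<and> X (Suc k) \<omega> = v)
        = \<P>(\<omega> in M. X k \<omega> = u \<and> X (Suc k) \<omega> = v) * (\<P>(\<omega> in M. ?H \<omega>) / \<P>(\<omega> in M. X k \<omega> = u))"
      for v
    proof -
      \<comment> \<open>\<open>markov_chain\<close> reads the past and the next state off one
        trajectory, so \<open>h\<close> is prolonged by \<open>v\<close> at time
        \<open>Suc k\<close>.\<close>
      let ?x = "h(Suc k := v)"
      have e: "(\<forall>t\<le>k. X t \<omega> = ?x t) \<longleftrightarrow> ?H \<omega>" for \<omega> by auto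
      have "\<P>(\<omega> in M. X (Suc k) \<omega> = ?x (Suc k) \<bar> \<forall>t\<le>k. X t \<omega> = ?x t) =
          \<P>(\<omega> in M. X (Suc k) \<omega> = ?x (Suc k) \<bar> X k \<omega> = ?x k)"
        using mc True unfolding markov_chain_def e[symmetric] by blast
      then show ?thesis
        using True pu hk unfolding e cond_prob_def by (simp add: field_simps conj_commute)
    qed
    have H: "Measurable.pred M ?H" and Xu: "Measurable.pred M (\<lambda>\<omega>. X k \<omega> = u)" by measurable
    have "\<P>(\<omega> in M. ?H \<omega> \<and> B (X (Suc k) \<omega>))
        = \<P>(\<omega> in M. X k \<omega> = u \<and> B (X (Suc k) \<omega>)) * (\<P>(\<omega> in M. ?H \<omega>) / \<P>(\<omega> in M. X k \<omega> = u))"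
      by (simp only: split[OF H] split[OF Xu] one sum_distrib_right)
    then show ?thesis using step pu by simp
  next
    case False
    then have "\<P>(\<omega> in M. ?H \<omega>) = 0" by (simp add: zero_less_measure_iff)
    moreover have "\<P>(\<omega> in M. ?H \<omega> \<and> B (X (Suc k) \<omega>)) \<le> \<P>(\<omega> in M. ?H \<omega>)"
      by (intro finite_measure_mono) auto
    ultimately show ?thesis by (simp add: measure_le_0_iff)
  qed
qed

text \<open>For \<open>j < k\<close> the factor at time \<open>j\<close> is determined by the
  history up to \<open>k\<close>, because \<open>Suc j \<le> k\<close>, while the factor at time
  \<open>k\<close> has mean 0 given that history. Hence the terms are uncorrelated.\<close>

lemma (in prob_space) markov_chain_transition_slln:
  assumes S: "finite S" and mc: "markov_chain M S X"
    and step: "\<And>k. \<P>(\<omega> in M. X k \<omega> = u \<and> B (X (Suc k) \<omega>)) = \<pi> * \<P>(\<omega> in M. X k \<omega> = u)"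
    and pi: "0 \<le> \<pi>" "\<pi> \<le> 1"
  shows "AE \<omega> in M. (\<lambda>n. (\<Sum>k<n. of_bool (X k \<omega> = u) * (of_bool (B (X (Suc k) \<omega>)) - \<pi>)) / real n)
    \<longlonglongrightarrow> 0"
proof (rule slln_bounded_uncorrelated)
  have X[measurable]: "X k \<in> measurable M (count_space S)" for k
    using mc by (simp add: markov_chain_def)
  have XS: "X k \<omega> \<in> S" if "\<omega> \<in> space M" for k \<omega>
    using measurable_space[OF _ that, of "X k" "count_space S"] by simp
  have [measurable]: "Measurable.pred M (\<lambda>\<omega>. P (X k \<omega>))" for k P
  proof -
    have "Measurable.pred (count_space S) P" by simp
    then show ?thesis by measurable
  qed
  let ?d = "\<lambda>x y. of_bool (x = u) * (of_bool (B y) - \<pi>)"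
  show "random_variable borel (\<lambda>\<omega>. ?d (X k \<omega>) (X (Suc k) \<omega>))" for k
    unfolding of_bool_def by measurable
  show "\<bar>?d (X k \<omega>) (X (Suc k) \<omega>)\<bar> \<le> 1" for k \<omega>
    using pi by (auto simp: of_bool_def)
  fix j k :: nat assume jk: "j < k"
  let ?Hs = "{..k} \<rightarrow>\<^sub>E S"
  let ?ev = "\<lambda>h \<omega>. \<forall>t\<le>k. X t \<omega> = h t"
  have fin: "finite ?Hs" using S by (intro finite_PiE) auto
  \<comment> \<open>Exactly one history \<open>h\<close> is realised by each \<omega>, so the
    product can be expanded over all histories with coefficients that depend on \<open>h\<close>
    only.\<close>
  have "?d (X j \<omega>) (X (Suc j) \<omega>) * ?d (X k \<omega>) (X (Suc k) \<omega>)
      = (\<Sum>h\<in>?Hs. ?d (h j) (h (Suc j)) * of_bool (h k = u) *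
          (of_bool (?ev h \<omega> \<and> B (X (Suc k) \<omega>)) - \<pi> * of_bool (?ev h \<omega>)))"
    if "\<omega> \<in> space M" for \<omega>
  proof -
    \<comment> \<open>The functions in \<open>?Hs\<close> are \<open>undefined\<close> outside
      \<open>{..k}\<close>, hence the restriction.\<close>
    let ?h = "restrict (\<lambda>t. X t \<omega>) {..k}"
    have h: "?h \<in> ?Hs" using XS[OF that] by auto
    have ev: "?ev h \<omega> \<longleftrightarrow> h = ?h" if "h \<in> ?Hs" for h
    proof
      assume "?ev h \<omega>"
      then show "h = ?h" by (intro PiE_ext[OF that h]) simp
    qed simp
    have "(\<Sum>h\<in>?Hs. ?d (h j) (h (Suc j)) * of_bool (h k = u) *
          (of_bool (?ev h \<omega> \<and> B (X (Suc k) \<omega>)) - \<pi> * of_bool (?ev h \<omega>)))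
      = (\<Sum>h\<in>?Hs. if h = ?h then ?d (h j) (h (Suc j)) * ?d (h k) (X (Suc k) \<omega>) else 0)"
    proof (rule sum.cong[OF refl])
      fix h assume "h \<in> ?Hs"
      show "?d (h j) (h (Suc j)) * of_bool (h k = u) *
          (of_bool (?ev h \<omega> \<and> B (X (Suc k) \<omega>)) - \<pi> * of_bool (?ev h \<omega>))
        = (if h = ?h then ?d (h j) (h (Suc j)) * ?d (h k) (X (Suc k) \<omega>) else 0)"
        unfolding ev[OF \<open>h \<in> ?Hs\<close>] by (cases "h = ?h") (simp_all add: mult.assoc)
    qed
    also have "\<dots> = ?d (X j \<omega>) (X (Suc j) \<omega>) * ?d (X k \<omega>) (X (Suc k) \<omega>)"
      using h fin jk by (simp add: sum.delta)
    finally show ?thesis by simp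
  qed
  then have "expectation (\<lambda>\<omega>. ?d (X j \<omega>) (X (Suc j) \<omega>) * ?d (X k \<omega>) (X (Suc k) \<omega>))
      = expectation (\<lambda>\<omega>. \<Sum>h\<in>?Hs. ?d (h j) (h (Suc j)) * of_bool (h k = u) *
          (of_bool (?ev h \<omega> \<and> B (X (Suc k) \<omega>)) - \<pi> * of_bool (?ev h \<omega>)))"
    by (intro Bochner_Integration.integral_cong refl) simp
  also have "\<dots> = (\<Sum>h\<in>?Hs. ?d (h j) (h (Suc j)) * of_bool (h k = u) *
      (\<P>(\<omega> in M. ?ev h \<omega> \<and> B (X (Suc k) \<omega>)) - \<pi> * \<P>(\<omega> in M. ?ev h \<omega>)))"
  proof -
    have b: "integrable M (\<lambda>\<omega>. of_bool (P \<omega>) :: real)"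
        "expectation (\<lambda>\<omega>. of_bool (P \<omega>) :: real) = \<P>(\<omega> in M. P \<omega>)"
      if [measurable]: "Measurable.pred M P" for P
    proof -
      have e: "of_bool (P \<omega>) = (indicator {\<omega>\<in>space M. P \<omega>} \<omega> :: real)" if "\<omega> \<in> space M" for \<omega>
        using that by (auto simp: indicator_def)
      show "integrable M (\<lambda>\<omega>. of_bool (P \<omega>) :: real)"
        by (rule integrable_const_bound[of _ 1]) (auto simp: of_bool_def)
      have "expectation (\<lambda>\<omega>. of_bool (P \<omega>) :: real) = expectation (indicat_real {\<omega>\<in>space M. P \<omega>})"
        using e by (intro Bochner_Integration.integral_cong) auto
      then show "expectation (\<lambda>\<omega>. of_bool (P \<omega>) :: real) = \<P>(\<omega> in M. P \<omega>)" by simp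
    qed
    show ?thesis
      by (simp add: b)
  qed
  also have "\<dots> = 0"
  proof (rule sum.neutral, rule ballI)
    fix h
    \<comment> \<open>If \<open>h k \<noteq> u\<close> the indicator vanishes; otherwise the Markov
      property along \<open>h\<close> makes the last factor 0.\<close>
    show "?d (h j) (h (Suc j)) * of_bool (h k = u) *
      (\<P>(\<omega> in M. ?ev h \<omega> \<and> B (X (Suc k) \<omega>)) - \<pi> * \<P>(\<omega> in M. ?ev h \<omega>)) = 0"
      using markov_chain_prob_history[OF S mc _ step, where h = h and k = k] by (cases "h k = u") auto
  qed
  finally show "expectation (\<lambda>\<omega>. ?d (X j \<omega>) (X (Suc j) \<omega>) * ?d (X k \<omega>) (X (Suc k) \<omega>)) = 0" .
qed

section \<open>Pathwise analysis of the likelihood\<close>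

text \<open>Via the Hellinger distance, using \<open>ln x \<le> x - 1\<close> at \<open>x = sqrt (q / p)\<close>.\<close>

lemma kl_bernoulli_ge:
  fixes p q :: real
  assumes p: "0 < p" "p < 1" and q: "0 < q" "q < 1"
  shows "p * (ln p - ln q) + (1 - p) * (ln (1 - p) - ln (1 - q)) \<ge> (p - q)\<^sup>2 / 4"
proof -
  have sq: "x * (ln x - ln y) \<ge> 2 * x - 2 * (sqrt x * sqrt y)" if "0 < x" "0 < y" for x y :: real
  proof -
    have "ln (sqrt (y / x)) \<le> sqrt (y / x) - 1"
      using that by (intro ln_le_minus_one) simp
    moreover have "ln (sqrt (y / x)) = (ln y - ln x) / 2"
      using that by (simp add: ln_sqrt ln_div)
    ultimately have "(ln y - ln x) / 2 \<le> sqrt y / sqrt x - 1"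
      by (simp only: real_sqrt_divide)
    then have "x * ((ln y - ln x) / 2) \<le> x * (sqrt y / sqrt x - 1)"
      using that by (intro mult_left_mono) auto
    also have "\<dots> = sqrt x * sqrt y - x"
      using that by (simp add: field_simps flip: power2_eq_square)
    finally show ?thesis by (simp add: field_simps)
  qed
  \<comment> \<open>The second factor is at most 4, which is the source of the constant
    \<open>1 / 4\<close>.\<close>
  have "(p - q)\<^sup>2 = (sqrt p - sqrt q)\<^sup>2 * (sqrt p + sqrt q)\<^sup>2"
    using p q by (simp flip: power_mult_distrib) (simp add: algebra_simps)
  also have "\<dots> \<le> (sqrt p - sqrt q)\<^sup>2 * 4"
  proof (intro mult_left_mono)
    have "sqrt p + sqrt q \<le> 2" using p q real_sqrt_le_1_iff[of p] real_sqrt_le_1_iff[of q] by linarith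
    then have "(sqrt p + sqrt q)\<^sup>2 \<le> 2\<^sup>2" using p q by (intro power_mono) auto
    then show "(sqrt p + sqrt q)\<^sup>2 \<le> 4" by simp
  qed simp
  finally have "(p - q)\<^sup>2 / 4 \<le> (sqrt p - sqrt q)\<^sup>2" by simp
  also have "\<dots> \<le> (sqrt p - sqrt q)\<^sup>2 + (sqrt (1 - p) - sqrt (1 - q))\<^sup>2" by simp
  \<comment> \<open>Expanding gives 2 minus the two mixed terms; 2 is written as
    \<open>2 * p + 2 * (1 - p)\<close> so that \<open>sq\<close> applies to each outcome
    separately.\<close>
  also have "\<dots> = 2 * p - 2 * (sqrt p * sqrt q) + (2 * (1 - p) - 2 * (sqrt (1 - p) * sqrt (1 - q)))"
    using p q by (simp add: power2_diff)
  also have "\<dots> \<le> p * (ln p - ln q) + (1 - p) * (ln (1 - p) - ln (1 - q))"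
    using p q by (intro add_mono sq) auto
  finally show ?thesis .
qed

section \<open>Bounds on the success probabilities and recovery of the parameter from them\<close>

text \<open>The linear part lies between 0 and the row sum \<open>1 - b $ i\<close>, so the noise
  alone keeps the probability away from 0 and 1. These uniform bounds control the logarithms and
  make all transition probabilities positive.\<close>

lemma success_prob_bounds:
  fixes \<theta> :: "'p::finite bar_param"
  assumes \<theta>: "\<theta> \<in> param_space bmin \<rho>min \<rho>max" and u: "u \<in> binary_cube"
    and bnds: "0 < bmin" "0 < \<rho>min" "\<rho>max < 1"
  shows "bmin * \<rho>min \<le> success_prob \<theta> i u" "success_prob \<theta> i u \<le> 1 - bmin * (1 - \<rho>max)"
proof -
  obtain A A' b \<rho> where [simp]: "\<theta> = (A, A', b, \<rho>)" by (cases \<theta>)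
  have sum1: "(\<Sum>j\<in>UNIV. A $ i $ j + A' $ i $ j) + b $ i = 1"
    and b: "bmin \<le> b $ i" and \<rho>: "\<rho>min \<le> \<rho> $ i" "\<rho> $ i \<le> \<rho>max"
    and nn: "\<And>j. 0 \<le> A $ i $ j" "\<And>j. 0 \<le> A' $ i $ j"
    using \<theta> by (auto simp: param_space_def)
  have u01: "u $ j \<in> {0, 1}" for j using u by (auto simp: binary_cube_def)
  have lin: "A $ i \<bullet> u + A' $ i \<bullet> (1 - u) = (\<Sum>j\<in>UNIV. A $ i $ j * u $ j + A' $ i $ j * (1 - u $ j))"
    by (simp add: inner_vec_def sum.distrib)
  have "0 \<le> A $ i \<bullet> u + A' $ i \<bullet> (1 - u)"
    unfolding lin
  proof (rule sum_nonneg)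
    fix j show "0 \<le> A $ i $ j * u $ j + A' $ i $ j * (1 - u $ j)"
      using u01[of j] nn[of j] by auto
  qed
  moreover have "bmin * \<rho>min \<le> b $ i * \<rho> $ i"
    using b \<rho> bnds by (intro mult_mono) auto
  ultimately show "bmin * \<rho>min \<le> success_prob \<theta> i u" by (simp add: mult.commute)
  have "A $ i \<bullet> u + A' $ i \<bullet> (1 - u) \<le> (\<Sum>j\<in>UNIV. A $ i $ j + A' $ i $ j)"
    unfolding lin
  proof (rule sum_mono)
    fix j show "A $ i $ j * u $ j + A' $ i $ j * (1 - u $ j) \<le> A $ i $ j + A' $ i $ j"
      using u01[of j] nn[of j] by auto
  qed
  moreover have "bmin * (1 - \<rho>max) \<le> b $ i * (1 - \<rho> $ i)"
    using b \<rho> bnds by (intro mult_mono) auto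
  ultimately show "success_prob \<theta> i u \<le> 1 - bmin * (1 - \<rho>max)"
    using sum1 by (simp add: algebra_simps)
qed

text \<open>The differences \<open>A - A'\<close> are read off the success probabilities at \<open>0\<close> and at the unit vectors,
  and \<open>A\<close>, \<open>A'\<close> are their positive and negative parts because \<open>a\<^sub>i\<^sub>j a'\<^sub>i\<^sub>j = 0\<close>.\<close>

lemma param_eq_of_success_prob:
  fixes A A' :: "real ^ 'p::finite ^ 'p"
  assumes "(A, A', b, \<rho>) \<in> param_space bmin \<rho>min \<rho>max" and "0 < bmin"
  defines "q \<equiv> success_prob (A, A', b, \<rho>)"
  shows "A $ i $ j = max 0 (q i (axis j 1) - q i 0)"
    and "A' $ i $ j = max 0 (q i 0 - q i (axis j 1))"
    and "b $ i = 1 - (\<Sum>j\<in>UNIV. A $ i $ j + A' $ i $ j)"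
    and "\<rho> $ i = (q i 0 - (\<Sum>j\<in>UNIV. A' $ i $ j)) / b $ i"
proof -
  have b: "(\<Sum>j\<in>UNIV. A $ i $ j + A' $ i $ j) + b $ i = 1" "0 < b $ i"
    and nn: "0 \<le> A $ i $ j" "0 \<le> A' $ i $ j" "A $ i $ j * A' $ i $ j = 0"
    using assms by (auto simp: param_space_def intro: less_le_trans)
  have d: "q i (axis j 1) - q i 0 = A $ i $ j - A' $ i $ j"
    by (simp add: q_def inner_diff_right inner_axis)
  show "A $ i $ j = max 0 (q i (axis j 1) - q i 0)"
    unfolding d using nn by auto
  have d': "q i 0 - q i (axis j 1) = A' $ i $ j - A $ i $ j" using d by simp
  show "A' $ i $ j = max 0 (q i 0 - q i (axis j 1))"
    unfolding d' using nn by auto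
  show "b $ i = 1 - (\<Sum>j\<in>UNIV. A $ i $ j + A' $ i $ j)" using b by simp
  have "q i 0 = (\<Sum>j\<in>UNIV. A' $ i $ j) + \<rho> $ i * b $ i"
    by (simp add: q_def inner_vec_def)
  then show "\<rho> $ i = (q i 0 - (\<Sum>j\<in>UNIV. A' $ i $ j)) / b $ i"
    using b by simp
qed

text \<open>The four inversion formulas are continuous, the last one because \<open>b0 $ i\<close>
  is nonzero. Membership is required eventually only, since nothing is known of the estimator at
  time 0.\<close>

lemma param_tendsto_of_success_prob_tendsto:
  fixes \<theta> :: "nat \<Rightarrow> 'p::finite bar_param"
  assumes \<theta>: "\<forall>\<^sub>F n in sequentially. \<theta> n \<in> param_space bmin \<rho>min \<rho>max"
    and \<theta>0: "\<theta>0 \<in> param_space bmin \<rho>min \<rho>max" and bmin: "0 < bmin"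
    and lim: "\<And>i u. u \<in> binary_cube \<Longrightarrow> (\<lambda>n. success_prob (\<theta> n) i u) \<longlonglongrightarrow> success_prob \<theta>0 i u"
  shows "\<theta> \<longlonglongrightarrow> \<theta>0"
proof -
  define A A' b \<rho> where "A n = fst (\<theta> n)" and "A' n = fst (snd (\<theta> n))"
    and "b n = fst (snd (snd (\<theta> n)))" and "\<rho> n = snd (snd (snd (\<theta> n)))" for n
  have \<theta>_eq: "\<theta> n = (A n, A' n, b n, \<rho> n)" for n
    by (simp add: A_def A'_def b_def \<rho>_def)
  have \<theta>': "\<forall>\<^sub>F n in sequentially. (A n, A' n, b n, \<rho> n) \<in> param_space bmin \<rho>min \<rho>max"
    using \<theta> by (simp only: \<theta>_eq)
  obtain A0 A0' b0 \<rho>0 where \<theta>0_eq: "\<theta>0 = (A0, A0', b0, \<rho>0)" by (cases \<theta>0)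
  note eqs = param_eq_of_success_prob[OF _ bmin]
  note eqs0 = eqs[OF \<theta>0[unfolded \<theta>0_eq], folded \<theta>0_eq]
  have cube: "0 \<in> binary_cube" "axis j 1 \<in> binary_cube" for j :: 'p
    by (auto simp: binary_cube_def axis_def)
  have A: "(\<lambda>n. A n $ i $ j) \<longlonglongrightarrow> A0 $ i $ j" for i j
  proof (rule Lim_transform_eventually)
    show "(\<lambda>n. max 0 (success_prob (\<theta> n) i (axis j 1) - success_prob (\<theta> n) i 0)) \<longlonglongrightarrow> A0 $ i $ j"
      unfolding eqs0(1) by (intro tendsto_intros lim cube)
    show "\<forall>\<^sub>F n in sequentially.
        max 0 (success_prob (\<theta> n) i (axis j 1) - success_prob (\<theta> n) i 0) = A n $ i $ j"
      using \<theta>' unfolding \<theta>_eq by eventually_elim (erule eqs(1)[symmetric])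
  qed
  have A': "(\<lambda>n. A' n $ i $ j) \<longlonglongrightarrow> A0' $ i $ j" for i j
  proof (rule Lim_transform_eventually)
    show "(\<lambda>n. max 0 (success_prob (\<theta> n) i 0 - success_prob (\<theta> n) i (axis j 1))) \<longlonglongrightarrow> A0' $ i $ j"
      unfolding eqs0(2) by (intro tendsto_intros lim cube)
    show "\<forall>\<^sub>F n in sequentially.
        max 0 (success_prob (\<theta> n) i 0 - success_prob (\<theta> n) i (axis j 1)) = A' n $ i $ j"
      using \<theta>' unfolding \<theta>_eq by eventually_elim (erule eqs(2)[symmetric])
  qed
  have b: "(\<lambda>n. b n $ i) \<longlonglongrightarrow> b0 $ i" for i
  proof (rule Lim_transform_eventually)
    show "(\<lambda>n. 1 - (\<Sum>j\<in>UNIV. A n $ i $ j + A' n $ i $ j)) \<longlonglongrightarrow> b0 $ i"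
      unfolding eqs0(3) by (intro tendsto_intros A A')
    show "\<forall>\<^sub>F n in sequentially. 1 - (\<Sum>j\<in>UNIV. A n $ i $ j + A' n $ i $ j) = b n $ i"
      using \<theta>' unfolding \<theta>_eq by eventually_elim (erule eqs(3)[symmetric])
  qed
  have b0: "b0 $ i \<noteq> 0" for i
    using \<theta>0 bmin by (auto simp: \<theta>0_eq param_space_def dest!: spec[of _ i])
  have \<rho>: "(\<lambda>n. \<rho> n $ i) \<longlonglongrightarrow> \<rho>0 $ i" for i
  proof (rule Lim_transform_eventually)
    show "(\<lambda>n. (success_prob (\<theta> n) i 0 - (\<Sum>j\<in>UNIV. A' n $ i $ j)) / b n $ i) \<longlonglongrightarrow> \<rho>0 $ i"
      unfolding eqs0(4) by (intro tendsto_intros A' b b0 lim cube)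
    show "\<forall>\<^sub>F n in sequentially.
        (success_prob (\<theta> n) i 0 - (\<Sum>j\<in>UNIV. A' n $ i $ j)) / b n $ i = \<rho> n $ i"
      using \<theta>' unfolding \<theta>_eq by eventually_elim (erule eqs(4)[symmetric])
  qed
  have "(\<lambda>n. (A n, A' n, b n, \<rho> n)) \<longlonglongrightarrow> (A0, A0', b0, \<rho>0)"
    by (intro tendsto_Pair vec_tendstoI A A' b \<rho>)
  then show ?thesis by (simp add: \<theta>_eq[symmetric] \<theta>0_eq)
qed

section \<open>The likelihood difference and its consequences at a maximiser\<close>

text \<open>Each observed bit is split into its conditional mean under \<theta>0 and a centred
  fluctuation, and times are grouped by the current state. The fluctuations give the first term; the
  means give minus the visit frequency times a Kullback-Leibler divergence.\<close>

lemma log_likelihood_diff: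
  fixes \<theta> \<theta>0 :: "'p::finite bar_param"
  assumes x: "\<And>k. x k \<in> binary_cube"
  defines "\<alpha> \<equiv> \<lambda>i u. ln (success_prob \<theta> i u) - ln (success_prob \<theta>0 i u)"
    and "\<beta> \<equiv> \<lambda>i u. ln (1 - success_prob \<theta> i u) - ln (1 - success_prob \<theta>0 i u)"
  shows "log_likelihood P0 T x \<theta> - log_likelihood P0 T x \<theta>0 =
    (\<Sum>u\<in>binary_cube. \<Sum>i\<in>UNIV.
      (\<Sum>k<T. of_bool (x k = u) * (of_bool (x (Suc k) $ i = 1) - success_prob \<theta>0 i u)) / T
          * (\<alpha> i u - \<beta> i u)
      - (\<Sum>k<T. of_bool (x k = u)) / T
          * (success_prob \<theta>0 i u * (- \<alpha> i u) + (1 - success_prob \<theta>0 i u) * (- \<beta> i u)))"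
proof -
  \<comment> \<open>The statement carries minus signs to display a divergence; \<open>neg\<close>
    removes them to match \<open>?g\<close>.\<close>
  have neg: "a - b * (c * (- d) + e * (- f)) = a + b * (c * d + e * f)" for a b c d e f :: real
    by (simp add: algebra_simps)
  let ?q = "success_prob \<theta>0"
  let ?g = "\<lambda>k i u. (of_bool (x (Suc k) $ i = 1) - ?q i u) * (\<alpha> i u - \<beta> i u)
      + (?q i u * \<alpha> i u + (1 - ?q i u) * \<beta> i u)"
  have x01: "x k $ i = of_bool (x k $ i = 1)" for k i
    using x[of k] by (auto simp: binary_cube_def dest!: spec[of _ i])
  have step: "(\<Sum>i\<in>UNIV. x (Suc k) $ i * ln (success_prob \<theta> i (x k)) +
        (1 - x (Suc k) $ i) * ln (1 - success_prob \<theta> i (x k))) -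
      (\<Sum>i\<in>UNIV. x (Suc k) $ i * ln (?q i (x k)) + (1 - x (Suc k) $ i) * ln (1 - ?q i (x k)))
      = (\<Sum>u\<in>binary_cube. \<Sum>i\<in>UNIV. of_bool (x k = u) * ?g k i u)" (is "?l - ?r = _") for k
  proof -
    have "?l - ?r = (\<Sum>i\<in>UNIV. ?g k i (x k))"
      unfolding sum_subtractf[symmetric]
    proof (rule sum.cong[OF refl])
      fix i
      show "x (Suc k) $ i * ln (success_prob \<theta> i (x k)) +
        (1 - x (Suc k) $ i) * ln (1 - success_prob \<theta> i (x k)) -
        (x (Suc k) $ i * ln (?q i (x k)) + (1 - x (Suc k) $ i) * ln (1 - ?q i (x k))) = ?g k i (x k)"
        by (subst (1 2 3 4) x01) (simp add: \<alpha>_def \<beta>_def algebra_simps)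
    qed
    also have "\<dots> = (\<Sum>u\<in>binary_cube. if x k = u then (\<Sum>i\<in>UNIV. ?g k i u) else 0)"
      by (simp add: sum.delta' finite_binary_cube x)
    also have "\<dots> = (\<Sum>u\<in>binary_cube. \<Sum>i\<in>UNIV. of_bool (x k = u) * ?g k i u)"
      by (intro sum.cong) auto
    finally show ?thesis .
  qed
  \<comment> \<open>The initial term is common to both parameters and cancels, whatever its
    value.\<close>
  have "log_likelihood P0 T x \<theta> - log_likelihood P0 T x \<theta>0
    = (\<Sum>k<T. \<Sum>u\<in>binary_cube. \<Sum>i\<in>UNIV. of_bool (x k = u) * ?g k i u) / T"
    unfolding log_likelihood_def step[symmetric] sum_subtractf
    by (simp add: diff_divide_distrib)
  also have "(\<Sum>k<T. \<Sum>u\<in>binary_cube. \<Sum>i\<in>UNIV. of_bool (x k = u) * ?g k i u)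
    = (\<Sum>u\<in>binary_cube. \<Sum>k<T. \<Sum>i\<in>UNIV. of_bool (x k = u) * ?g k i u)"
    by (rule sum.swap)
  also have "\<dots> = (\<Sum>u\<in>binary_cube. \<Sum>i\<in>UNIV. \<Sum>k<T. of_bool (x k = u) * ?g k i u)"
    by (intro sum.cong refl sum.swap)
  finally show ?thesis
    unfolding neg by (simp add: sum_divide_distrib sum_distrib_right distrib_left sum.distrib add_divide_distrib mult.assoc)
qed

text \<open>Comparing the maximiser with \<theta>0 bounds the frequency-weighted sum of divergences
  by an error that vanishes through \<open>err\<close>. Once the frequencies are at least
  \<open>c\<close>, each squared difference of success probabilities is at most \<open>4 / c\<close>
  times that error.\<close>

lemma success_prob_tendsto_of_arg_max:
  fixes \<theta>hat :: "nat \<Rightarrow> 'p::finite bar_param"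
  assumes bnds: "0 < bmin" "0 < \<rho>min" "\<rho>max < 1"
    and \<theta>0: "\<theta>0 \<in> param_space bmin \<rho>min \<rho>max"
    and x: "\<And>k. x k \<in> binary_cube"
    and am: "\<And>T. T \<ge> 1 \<Longrightarrow> is_arg_max (log_likelihood P0 T x)
             (\<lambda>\<theta>. \<theta> \<in> param_space bmin \<rho>min \<rho>max) (\<theta>hat T)"
    and err: "\<And>u i. u \<in> binary_cube \<Longrightarrow> (\<lambda>T. (\<Sum>k<T. of_bool (x k = u) *
             (of_bool (x (Suc k) $ i = 1) - success_prob \<theta>0 i u)) / T) \<longlonglongrightarrow> 0"
    and freq: "\<And>u. u \<in> binary_cube \<Longrightarrow> \<forall>\<^sub>F T in sequentially. (\<Sum>k<T. of_bool (x k = u)) / T \<ge> c"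
    and c: "0 < c" and u: "u \<in> binary_cube"
  shows "(\<lambda>T. success_prob (\<theta>hat T) i u) \<longlonglongrightarrow> success_prob \<theta>0 i u"
proof -
  let ?qz = "success_prob \<theta>0" and ?q = "\<lambda>T. success_prob (\<theta>hat T)"
  let ?\<alpha> = "\<lambda>T i u. ln (?q T i u) - ln (?qz i u)"
  let ?\<beta> = "\<lambda>T i u. ln (1 - ?q T i u) - ln (1 - ?qz i u)"
  let ?E = "\<lambda>T i u. (\<Sum>k<T. of_bool (x k = u) * (of_bool (x (Suc k) $ i = 1) - ?qz i u)) / T"
  let ?N = "\<lambda>T u. (\<Sum>k<T. of_bool (x k = u)) / real T"
  let ?kl = "\<lambda>T i u. ?qz i u * (- ?\<alpha> T i u) + (1 - ?qz i u) * (- ?\<beta> T i u)"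
  \<comment> \<open>All logarithms involved lie between one of these two and 0, so
    \<open>2 * L\<close> is a crude bound, uniform in \<open>T\<close>, on the coefficient of each
    fluctuation.\<close>
  define L where "L = - ln (bmin * \<rho>min) - ln (bmin * (1 - \<rho>max))"
  define R where "R T = (\<Sum>u\<in>binary_cube. \<Sum>i\<in>UNIV. \<bar>?E T i u\<bar> * (2 * L))" for T
  have lo: "0 < bmin * \<rho>min" "0 < bmin * (1 - \<rho>max)" using bnds by auto
  have R0: "(\<lambda>T. 4 / c * R T) \<longlonglongrightarrow> 0"
  proof -
    have "R \<longlonglongrightarrow> (\<Sum>u\<in>(binary_cube :: (real ^ 'p) set). \<Sum>i\<in>(UNIV :: 'p set). \<bar>0\<bar> * (2 * L))"
      unfolding R_def by (intro tendsto_sum tendsto_mult tendsto_const tendsto_rabs err)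
    then have "(\<lambda>T. 4 / c * R T) \<longlonglongrightarrow> 4 / c * 0"
      by (intro tendsto_mult tendsto_const) simp
    then show ?thesis by simp
  qed
  have main: "(?q T i u - ?qz i u)\<^sup>2 \<le> 4 / c * R T" if T: "T \<ge> 1" and N: "?N T u \<ge> c" for T
  proof -
    have \<theta>T: "\<theta>hat T \<in> param_space bmin \<rho>min \<rho>max"
      using am[OF T] by (simp add: is_arg_max_def)
    note q = success_prob_bounds[OF \<theta>T _ bnds] and q0 = success_prob_bounds[OF \<theta>0 _ bnds]
    have pos: "0 < ?q T i u \<and> ?q T i u < 1 \<and> 0 < ?qz i u \<and> ?qz i u < 1" if "u \<in> binary_cube" for i u
      using q[OF that, of i] q0[OF that, of i] lo by linarith
    have kl: "(?qz i u - ?q T i u)\<^sup>2 / 4 \<le> ?kl T i u" if "u \<in> binary_cube" for i u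
      using kl_bernoulli_ge[of "?qz i u" "?q T i u"] pos[OF that, of i] by simp
    then have kl0: "0 \<le> ?kl T i u" if "u \<in> binary_cube" for i u
      using that order_trans[OF _ kl[OF that, of i]] by simp
    have N0: "0 \<le> ?N T u" for u by (simp add: sum_nonneg)
    have \<alpha>\<beta>: "\<bar>?\<alpha> T i u - ?\<beta> T i u\<bar> \<le> 2 * L" if u: "u \<in> binary_cube" for i u
    proof -
      have "ln (bmin * \<rho>min) \<le> ln (?q T i u)" "ln (bmin * \<rho>min) \<le> ln (?qz i u)"
        "ln (bmin * (1 - \<rho>max)) \<le> ln (1 - ?q T i u)" "ln (bmin * (1 - \<rho>max)) \<le> ln (1 - ?qz i u)"
        using q[OF u, of i] q0[OF u, of i] lo pos[OF u, of i] by (auto intro!: ln_mono)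
      moreover have "ln (?q T i u) \<le> 0" "ln (?qz i u) \<le> 0" "ln (1 - ?q T i u) \<le> 0" "ln (1 - ?qz i u) \<le> 0"
        using pos[OF u, of i] by auto
      moreover have "\<bar>a - a0 - (b - b0)\<bar> \<le> 2 * (- l - m)"
        if "l \<le> a" "l \<le> a0" "m \<le> b" "m \<le> b0" "a \<le> 0" "a0 \<le> 0" "b \<le> 0" "b0 \<le> 0"
        for a a0 b b0 l m :: real using that by (smt (verit))
      ultimately show ?thesis unfolding L_def by blast
    qed
    \<comment> \<open>The true parameter is a competitor of the maximiser; this is all that
      optimality contributes.\<close>
    have "\<not> log_likelihood P0 T x (\<theta>hat T) < log_likelihood P0 T x \<theta>0"
      using am[OF T] \<theta>0 unfolding is_arg_max_def by blast
    then have "0 \<le> (\<Sum>u\<in>binary_cube. \<Sum>i\<in>UNIV. ?E T i u * (?\<alpha> T i u - ?\<beta> T i u) - ?N T u * ?kl T i u)"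
      unfolding log_likelihood_diff[where x = x and \<theta> = "\<theta>hat T" and ?\<theta>0.0 = \<theta>0 and T = T and ?P0.0 = P0,
          OF x, symmetric]
      by simp
    also have "\<dots> \<le> (\<Sum>u\<in>binary_cube. \<Sum>i\<in>UNIV. \<bar>?E T i u\<bar> * (2 * L) - ?N T u * ?kl T i u)"
    proof (intro sum_mono diff_right_mono)
      fix u :: "real ^ 'p" and i assume "u \<in> binary_cube"
      have "?E T i u * (?\<alpha> T i u - ?\<beta> T i u) \<le> \<bar>?E T i u\<bar> * \<bar>?\<alpha> T i u - ?\<beta> T i u\<bar>"
        unfolding abs_mult[symmetric] by (rule abs_ge_self)
      also have "\<dots> \<le> \<bar>?E T i u\<bar> * (2 * L)"
        by (intro mult_left_mono \<alpha>\<beta> \<open>u \<in> binary_cube\<close>) simp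
      finally show "?E T i u * (?\<alpha> T i u - ?\<beta> T i u) \<le> \<bar>?E T i u\<bar> * (2 * L)" .
    qed
    finally have "(\<Sum>u\<in>binary_cube. \<Sum>i\<in>UNIV. ?N T u * ?kl T i u) \<le> R T"
      by (simp add: R_def sum_subtractf)
    \<comment> \<open>Weights and divergences are nonnegative, so one state and one coordinate can
      be isolated from the sum.\<close>
    moreover have "?N T u * ?kl T i u \<le> (\<Sum>i\<in>UNIV. ?N T u * ?kl T i u)"
      by (rule member_le_sum[where f = "\<lambda>i. ?N T u * ?kl T i u", OF UNIV_I _ finite])
        (intro mult_nonneg_nonneg N0 kl0 u)
    moreover have "\<dots> \<le> (\<Sum>u\<in>binary_cube. \<Sum>i\<in>UNIV. ?N T u * ?kl T i u)"
      by (rule member_le_sum[where f = "\<lambda>u. \<Sum>i\<in>UNIV. ?N T u * ?kl T i u", OF u _ finite_binary_cube])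
        (intro sum_nonneg mult_nonneg_nonneg N0 kl0, simp)
    moreover have "c * ((?qz i u - ?q T i u)\<^sup>2 / 4) \<le> ?N T u * ?kl T i u"
      using N c kl[OF u, of i] N0 by (intro mult_mono) auto
    ultimately have "c * ((?qz i u - ?q T i u)\<^sup>2 / 4) \<le> R T" by linarith
    then show ?thesis using c by (simp add: field_simps power2_commute)
  qed
  have "(\<lambda>T. (?q T i u - ?qz i u)\<^sup>2) \<longlonglongrightarrow> 0"
  proof (rule tendsto_sandwich[OF _ _ tendsto_const R0])
    show "\<forall>\<^sub>F T in sequentially. (?q T i u - ?qz i u)\<^sup>2 \<le> 4 / c * R T"
      using freq[OF u] eventually_ge_at_top[of 1] by eventually_elim (rule main)
  qed simp
  then have "(\<lambda>T. sqrt ((?q T i u - ?qz i u)\<^sup>2)) \<longlonglongrightarrow> sqrt 0" by (rule tendsto_real_sqrt)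
  then have "(\<lambda>T. ?q T i u - ?qz i u) \<longlonglongrightarrow> 0"
    by (simp add: tendsto_rabs_zero_iff)
  then show ?thesis by (simp add: LIM_zero_iff)
qed

section \<open>Lower bounds on visit frequencies\<close>

text \<open>Read \<open>Q u\<close> as the probability of a step from \<open>u\<close> to
  \<open>v\<close>. Summing the centred indicators over all \<open>u\<close> shows that, up to o(T),
  at least \<open>2 * c * T\<close> steps lead to \<open>v\<close>; the factor 2 leaves room for the
  error.\<close>

lemma eventually_frequency_ge:
  fixes x :: "nat \<Rightarrow> 's" and Q :: "'s \<Rightarrow> real"
  assumes S: "finite S" and x: "\<And>k. x k \<in> S" and Q: "\<And>u. u \<in> S \<Longrightarrow> 2 * c \<le> Q u" and c: "0 < c"
    and err: "\<And>u. u \<in> S \<Longrightarrow>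
      (\<lambda>T. (\<Sum>k<T. of_bool (x k = u) * (of_bool (x (Suc k) = v) - Q u)) / real T) \<longlonglongrightarrow> 0"
  shows "\<forall>\<^sub>F T in sequentially. c \<le> (\<Sum>k<T. of_bool (x k = v)) / real T"
proof -
  let ?F = "\<lambda>T. \<Sum>u\<in>S. (\<Sum>k<T. of_bool (x k = u) * (of_bool (x (Suc k) = v) - Q u)) / real T"
  \<comment> \<open>The extra \<open>1 / real T\<close> absorbs the boundary terms when arrivals in
    \<open>v\<close> at times 1 to T are converted into visits at times 0 to T - 1.\<close>
  have "(\<lambda>T. ?F T - 1 / real T) \<longlonglongrightarrow> (\<Sum>u\<in>S. 0) - 0"
    by (intro tendsto_diff tendsto_sum err lim_1_over_n)
  then have "\<forall>\<^sub>F T in sequentially. - c < ?F T - 1 / real T"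
    by (rule order_tendstoD) (use c in simp)
  then show ?thesis
    using eventually_gt_at_top[of 0]
  proof eventually_elim
    case (elim T)
    let ?N = "\<Sum>k<T. of_bool (x k = v) :: real"
    have "?F T * T = (\<Sum>u\<in>S. \<Sum>k<T. of_bool (x k = u) * (of_bool (x (Suc k) = v) - Q u))"
      using elim(2) by (simp flip: sum_divide_distrib)
    also have "\<dots> = (\<Sum>k<T. \<Sum>u\<in>S. if x k = u then of_bool (x (Suc k) = v) - Q u else 0)"
      by (subst sum.swap) (auto intro!: sum.cong)
    also have "\<dots> = (\<Sum>k<T. of_bool (x (Suc k) = v) - Q (x k))"
      by (simp add: sum.delta' S x)
    also have "\<dots> \<le> (\<Sum>k<T. of_bool (x (Suc k) = v) - 2 * c)"
      by (intro sum_mono diff_left_mono Q x)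
    also have "\<dots> = (\<Sum>k<T. of_bool (x (Suc k) = v)) - 2 * c * T"
      by (simp add: sum_subtractf)
    also have "(\<Sum>k<T. of_bool (x (Suc k) = v) :: real) = ?N + of_bool (x T = v) - of_bool (x 0 = v)"
      using sum.lessThan_Suc_shift[of "\<lambda>k. of_bool (x k = v) :: real" T] by simp
    also have "\<dots> \<le> ?N + 1" by (auto simp: of_bool_def)
    finally have le: "?F T * T \<le> ?N + 1 - 2 * c * T" by simp
    have "- c * T < (?F T - 1 / real T) * T"
      using elim by (intro mult_strict_right_mono) auto
    also have "\<dots> = ?F T * T - 1"
      using elim(2) by (simp add: left_diff_distrib)
    finally have "c * T \<le> ?N" using le by linarith
    then show ?case using elim(2) by (simp add: pos_le_divide_eq)
  qed
qed

section \<open>Transition probabilities of the BAR chain\<close>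

context prob_space
begin

lemma generic_BAR_measurable:
  assumes "generic_BAR M P0 \<theta> X W"
  shows "markov_chain M binary_cube X" "X k \<in> measurable M (count_space binary_cube)"
    "W (Suc k) \<in> measurable M (count_space binary_cube)"
  using assms by (cases \<theta>; simp add: markov_chain_def)+

text \<open>The model prescribes the law given both \<open>X k\<close> and the noise bit. Their
  independence lets the bit be averaged out, which turns \<open>b $ i * w\<close> into
  \<open>\<rho> $ i * b $ i\<close>.\<close>

lemma generic_BAR_entry_prob:
  fixes \<theta> :: "'p::finite bar_param"
  assumes BAR: "generic_BAR M P0 \<theta> X W" and u: "u \<in> binary_cube"
  shows "\<P>(\<omega> in M. X k \<omega> = u \<and> X (Suc k) \<omega> $ i = 1) = success_prob \<theta> i u * \<P>(\<omega> in M. X k \<omega> = u)"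
proof -
  obtain A A' b \<rho> where \<theta>: "\<theta> = (A, A', b, \<rho>)" by (cases \<theta>)
  note [measurable] = generic_BAR_measurable(2,3)[OF BAR]
  have [measurable]: "Measurable.pred M (\<lambda>\<omega>. P (X k \<omega>))" "Measurable.pred M (\<lambda>\<omega>. P (W (Suc k) \<omega>))"
    for P k
  proof -
    have [measurable]: "Measurable.pred (count_space binary_cube) P" by simp
    show "Measurable.pred M (\<lambda>\<omega>. P (X k \<omega>))" "Measurable.pred M (\<lambda>\<omega>. P (W (Suc k) \<omega>))"
      by measurable
  qed
  have W01: "W (Suc k) \<omega> $ i = 0 \<or> W (Suc k) \<omega> $ i = 1" if "\<omega> \<in> space M" for \<omega>
    using measurable_space[OF generic_BAR_measurable(3)[OF BAR] that, of k]
    by (auto simp: binary_cube_def)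
  let ?pX = "\<P>(\<omega> in M. X k \<omega> = u)" and ?pW = "\<lambda>w. \<P>(\<omega> in M. W (Suc k) \<omega> $ i = w)"
  let ?c = "\<lambda>\<omega> w. X k \<omega> = u \<and> W (Suc k) \<omega> $ i = w"
  have pW1: "?pW 1 = \<rho> $ i"
    using BAR by (simp add: \<theta>)
  have pW0: "?pW 0 = 1 - \<rho> $ i"
  proof -
    have "{\<omega> \<in> space M. W (Suc k) \<omega> $ i = 0} = {\<omega> \<in> space M. \<not> W (Suc k) \<omega> $ i = 1}"
      using W01 by auto
    then have "?pW 0 = \<P>(\<omega> in M. \<not> W (Suc k) \<omega> $ i = 1)" by simp
    also have "\<dots> = 1 - ?pW 1" by (rule prob_neg) measurable
    finally show ?thesis by (simp add: pW1)
  qed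
  have indep: "\<P>(\<omega> in M. ?c \<omega> w) = ?pX * ?pW w" for w
  proof -
    have "indep_var (count_space binary_cube) (W (Suc k)) (count_space binary_cube) (X k)"
      using BAR by (simp add: \<theta>)
    then have "prob ((\<lambda>\<omega>. (W (Suc k) \<omega>, X k \<omega>)) -` ({v \<in> binary_cube. v $ i = w} \<times> {u}) \<inter> space M)
        = prob (W (Suc k) -` {v \<in> binary_cube. v $ i = w} \<inter> space M) * prob (X k -` {u} \<inter> space M)"
      by (rule indep_varD) (use u in auto)
    moreover have "W (Suc k) \<omega> \<in> binary_cube" if "\<omega> \<in> space M" for \<omega>
      using measurable_space[OF generic_BAR_measurable(3)[OF BAR] that] by simp
    then have "(\<lambda>\<omega>. (W (Suc k) \<omega>, X k \<omega>)) -` ({v \<in> binary_cube. v $ i = w} \<times> {u}) \<inter> space M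
        = {\<omega> \<in> space M. ?c \<omega> w}"
      "W (Suc k) -` {v \<in> binary_cube. v $ i = w} \<inter> space M = {\<omega> \<in> space M. W (Suc k) \<omega> $ i = w}"
      "X k -` {u} \<inter> space M = {\<omega> \<in> space M. X k \<omega> = u}"
      by auto
    ultimately show ?thesis by (simp add: mult.commute)
  qed
  \<comment> \<open>Multiplying out the conditional probability keeps the identity valid when the
    conditioning event is null.\<close>
  have step: "\<P>(\<omega> in M. X (Suc k) \<omega> $ i = 1 \<and> ?c \<omega> w)
      = (A $ i \<bullet> u + A' $ i \<bullet> (1 - u) + b $ i * w) * \<P>(\<omega> in M. ?c \<omega> w)" for w
  proof (cases "\<P>(\<omega> in M. ?c \<omega> w) > 0")
    case True
    then have "\<P>(\<omega> in M. X (Suc k) \<omega> $ i = 1 \<bar> ?c \<omega> w)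
        = A $ i \<bullet> u + A' $ i \<bullet> (1 - u) + b $ i * w"
      using BAR by (simp add: \<theta>)
    with True show ?thesis unfolding cond_prob_def by (simp add: divide_eq_eq)
  next
    case False
    then have "\<P>(\<omega> in M. ?c \<omega> w) = 0" by (simp add: zero_less_measure_iff)
    moreover have "\<P>(\<omega> in M. X (Suc k) \<omega> $ i = 1 \<and> ?c \<omega> w) \<le> \<P>(\<omega> in M. ?c \<omega> w)"
      by (intro finite_measure_mono) auto
    ultimately show ?thesis by (simp add: measure_le_0_iff)
  qed
  have "{\<omega> \<in> space M. X k \<omega> = u \<and> X (Suc k) \<omega> $ i = 1}
      = {\<omega> \<in> space M. X (Suc k) \<omega> $ i = 1 \<and> ?c \<omega> 1} \<union> {\<omega> \<in> space M. X (Suc k) \<omega> $ i = 1 \<and> ?c \<omega> 0}"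
    using W01 by auto
  then have "\<P>(\<omega> in M. X k \<omega> = u \<and> X (Suc k) \<omega> $ i = 1)
      = \<P>(\<omega> in M. X (Suc k) \<omega> $ i = 1 \<and> ?c \<omega> 1) + \<P>(\<omega> in M. X (Suc k) \<omega> $ i = 1 \<and> ?c \<omega> 0)"
    by (simp only:) (rule finite_measure_Union, measurable, auto)
  also have "\<dots> = success_prob \<theta> i u * ?pX"
    unfolding step indep pW0 pW1 by (simp add: \<theta> algebra_simps)
  finally show ?thesis .
qed

text \<open>Conditional independence yields a product of entry probabilities, with the complementary
  one wherever \<open>v $ i = 0\<close>. A state \<open>u\<close> of probability 0 makes both sides
  vanish.\<close>

lemma generic_BAR_transition_prob:
  fixes \<theta> :: "'p::finite bar_param"
  assumes BAR: "generic_BAR M P0 \<theta> X W" and u: "u \<in> binary_cube" and v: "v \<in> binary_cube"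
  shows "\<P>(\<omega> in M. X k \<omega> = u \<and> X (Suc k) \<omega> = v)
    = (\<Prod>i\<in>UNIV. if v $ i = 1 then success_prob \<theta> i u else 1 - success_prob \<theta> i u)
      * \<P>(\<omega> in M. X k \<omega> = u)"
proof -
  note [measurable] = generic_BAR_measurable(2)[OF BAR]
  have [measurable]: "Measurable.pred M (\<lambda>\<omega>. P (X k \<omega>))" for P k
  proof -
    have [measurable]: "Measurable.pred (count_space binary_cube) P" by simp
    show "Measurable.pred M (\<lambda>\<omega>. P (X k \<omega>))" by measurable
  qed
  have X01: "X k \<omega> $ i = 0 \<or> X k \<omega> $ i = 1" if "\<omega> \<in> space M" for \<omega> k i
    using measurable_space[OF generic_BAR_measurable(2)[OF BAR] that, of k]
    by (auto simp: binary_cube_def)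
  let ?pX = "\<P>(\<omega> in M. X k \<omega> = u)"
  show ?thesis
  proof (cases "?pX > 0")
    case True
    have one: "\<P>(\<omega> in M. X (Suc k) \<omega> $ i = 1 \<bar> X k \<omega> = u) = success_prob \<theta> i u" for i
      using generic_BAR_entry_prob[OF BAR u, of k i] True
      unfolding cond_prob_def by (simp add: conj_commute)
    have entry: "\<P>(\<omega> in M. X (Suc k) \<omega> $ i = v $ i \<bar> X k \<omega> = u)
        = (if v $ i = 1 then success_prob \<theta> i u else 1 - success_prob \<theta> i u)" for i
    proof (cases "v $ i = 1")
      case False
      then have vi: "v $ i = 0" using v by (auto simp: binary_cube_def)
      have "{\<omega> \<in> space M. X (Suc k) \<omega> $ i = v $ i \<and> X k \<omega> = u}
          = {\<omega> \<in> space M. X k \<omega> = u} - {\<omega> \<in> space M. X (Suc k) \<omega> $ i = 1 \<and> X k \<omega> = u}"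
        using X01 by (auto simp: vi)
      then have "\<P>(\<omega> in M. X (Suc k) \<omega> $ i = v $ i \<and> X k \<omega> = u)
          = ?pX - \<P>(\<omega> in M. X (Suc k) \<omega> $ i = 1 \<and> X k \<omega> = u)"
        by (simp only:) (rule finite_measure_Diff, measurable, auto)
      then show ?thesis
        using one[of i] True False unfolding cond_prob_def by (simp add: diff_divide_distrib)
    qed (simp add: one)
    have "\<P>(\<omega> in M. X (Suc k) \<omega> = v \<bar> X k \<omega> = u)
        = (\<Prod>i\<in>UNIV. \<P>(\<omega> in M. X (Suc k) \<omega> $ i = v $ i \<bar> X k \<omega> = u))"
      using BAR True by (cases \<theta>) simp
    then have "\<P>(\<omega> in M. X (Suc k) \<omega> = v \<bar> X k \<omega> = u)
        = (\<Prod>i\<in>UNIV. if v $ i = 1 then success_prob \<theta> i u else 1 - success_prob \<theta> i u)"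
      by (simp only: entry)
    then show ?thesis
      using True unfolding cond_prob_def by (simp add: divide_eq_eq conj_commute)
  next
    case False
    then have "?pX = 0" by (simp add: zero_less_measure_iff)
    moreover have "\<P>(\<omega> in M. X k \<omega> = u \<and> X (Suc k) \<omega> = v) \<le> ?pX"
      by (intro finite_measure_mono) auto
    ultimately show ?thesis by (simp add: measure_le_0_iff)
  qed
qed

end

section \<open>Strong consistency\<close>

theorem mainTheorem4:
  fixes M :: "'a measure"
    and bmin \<rho>min \<rho>max :: real
    and P0 :: "(real ^ 'p::finite) pmf"
    and \<theta>0 :: "'p bar_param"
    and X W :: "nat \<Rightarrow> 'a \<Rightarrow> real ^ 'p"
    and \<theta>hat :: "nat \<Rightarrow> 'a \<Rightarrow> 'p bar_param"
  assumes "prob_space M"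
    and "0 < bmin" and "bmin < 1"
    and "0 < \<rho>min" and "\<rho>min < \<rho>max" and "\<rho>max < 1"
    and "\<theta>0 \<in> param_space bmin \<rho>min \<rho>max"
    and "set_pmf P0 \<subseteq> binary_cube"
    and "generic_BAR M P0 \<theta>0 X W"
    and "\<And>T. T \<ge> 1 \<Longrightarrow> AE \<omega> in M.
           is_arg_max (log_likelihood P0 T (\<lambda>k. X k \<omega>))
             (\<lambda>\<theta>. \<theta> \<in> param_space bmin \<rho>min \<rho>max) (\<theta>hat T \<omega>)"
  shows "AE \<omega> in M. (\<lambda>T. \<theta>hat T \<omega>) \<longlonglongrightarrow> \<theta>0"
proof -
  interpret prob_space M by fact
  note bnds = \<open>0 < bmin\<close> \<open>0 < \<rho>min\<close> \<open>\<rho>max < 1\<close>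
  note \<theta>0 = \<open>\<theta>0 \<in> param_space bmin \<rho>min \<rho>max\<close> and BAR = \<open>generic_BAR M P0 \<theta>0 X W\<close>
  note fin = finite_binary_cube[where 'p = 'p]
  note mc = generic_BAR_measurable(1)[OF BAR]
  define q0 where "q0 = success_prob \<theta>0"
  define Q where "Q u v = (\<Prod>i\<in>UNIV. if v $ i = 1 then q0 i u else 1 - q0 i u)" for u v :: "real ^ 'p"
  \<comment> \<open>\<open>m\<close> is below every factor of a transition probability, so
    \<open>m ^ CARD('p)\<close> is below the product; \<open>c\<close> is half of that, as
    \<open>eventually_frequency_ge\<close> requires.\<close>
  define m where "m = min (bmin * \<rho>min) (bmin * (1 - \<rho>max))"
  define c where "c = m ^ CARD('p) / 2"
  have m: "0 < m" using bnds by (simp add: m_def)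
  have q0: "m \<le> q0 i u" "m \<le> 1 - q0 i u" if "u \<in> binary_cube" for i u
    using success_prob_bounds[OF \<theta>0 that bnds, of i] by (auto simp: m_def q0_def min_le_iff_disj)
  have q01: "0 \<le> q0 i u" "q0 i u \<le> 1" if "u \<in> binary_cube" for i u
    using q0[OF that, of i] m by auto
  have Q: "2 * c \<le> Q u v" "0 \<le> Q u v" "Q u v \<le> 1" if "u \<in> binary_cube" for u v
  proof -
    have f: "m \<le> (if v $ i = 1 then q0 i u else 1 - q0 i u)
        \<and> (if v $ i = 1 then q0 i u else 1 - q0 i u) \<le> 1" for i
      using q0[OF that, of i] m by auto
    have "(\<Prod>i\<in>(UNIV :: 'p set). m) \<le> Q u v"
      unfolding Q_def using m f by (intro prod_mono) (auto simp: less_imp_le)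
    then show "2 * c \<le> Q u v" by (simp add: c_def)
    then show "0 \<le> Q u v" using m by (simp add: c_def) (meson order_trans zero_le_power less_imp_le)
    show "Q u v \<le> 1"
      unfolding Q_def using m f by (intro prod_le_1) (meson order_trans less_imp_le)
  qed
  \<comment> \<open>This family of limits removes the fluctuation terms of the likelihood.\<close>
  have entry: "AE \<omega> in M. \<forall>u\<in>binary_cube. \<forall>i. (\<lambda>T. (\<Sum>k<T. of_bool (X k \<omega> = u) *
      (of_bool (X (Suc k) \<omega> $ i = 1) - q0 i u)) / real T) \<longlonglongrightarrow> 0"
    by (intro AE_finite_allI fin AE_all_countable[THEN iffD2] allI
        markov_chain_transition_slln[OF fin mc, where B = "\<lambda>v. v $ _ = 1"]
        generic_BAR_entry_prob[OF BAR, folded q0_def] q01)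
  \<comment> \<open>The same law for single target states, which yields the visit
    frequencies.\<close>
  have trans: "AE \<omega> in M. \<forall>u\<in>binary_cube. \<forall>v\<in>binary_cube. (\<lambda>T. (\<Sum>k<T. of_bool (X k \<omega> = u) *
      (of_bool (X (Suc k) \<omega> = v) - Q u v)) / real T) \<longlonglongrightarrow> 0"
    by (intro AE_finite_allI fin markov_chain_transition_slln[OF fin mc, where B = "\<lambda>v. v = _"]
        generic_BAR_transition_prob[OF BAR, folded q0_def, folded Q_def] Q)
  \<comment> \<open>Each \<open>T\<close> has its own exceptional null set; their countable union is
    null.\<close>
  have am: "AE \<omega> in M. \<forall>T\<ge>1. is_arg_max (log_likelihood P0 T (\<lambda>k. X k \<omega>))
      (\<lambda>\<theta>. \<theta> \<in> param_space bmin \<rho>min \<rho>max) (\<theta>hat T \<omega>)"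
    using assms(10) by (simp add: AE_all_countable)
  show ?thesis
    using entry trans am AE_space
  proof eventually_elim
    case (elim \<omega>)
    \<comment> \<open>With \<omega> fixed outside the null sets, the pathwise lemmas apply to the
      trajectory \<open>\<lambda>k. X k \<omega>\<close>.\<close>
    have x: "X k \<omega> \<in> binary_cube" for k
      using measurable_space[OF generic_BAR_measurable(2)[OF BAR] elim(4)] by simp
    have c: "0 < c" using m by (simp add: c_def)
    have freq: "\<forall>\<^sub>F T in sequentially. c \<le> (\<Sum>k<T. of_bool (X k \<omega> = v)) / real T"
      if "v \<in> binary_cube" for v
      using elim(2) that
      by (intro eventually_frequency_ge[where x = "\<lambda>k. X k \<omega>" and Q = "\<lambda>u. Q u v", OF fin x Q(1) c]) auto
    have "(\<lambda>T. success_prob (\<theta>hat T \<omega>) i u) \<longlonglongrightarrow> success_prob \<theta>0 i u" if "u \<in> binary_cube" for i u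
      using elim(1,3)
      by (intro success_prob_tendsto_of_arg_max[OF bnds \<theta>0 x _ _ freq c that]) (auto simp: q0_def)
    moreover have "\<forall>\<^sub>F T in sequentially. \<theta>hat T \<omega> \<in> param_space bmin \<rho>min \<rho>max"
      using eventually_ge_at_top[of 1] by eventually_elim (use elim(3) in \<open>auto simp: is_arg_max_def\<close>)
    ultimately show ?case
      by (intro param_tendsto_of_success_prob_tendsto[OF _ \<theta>0 bnds(1)])
  qed
qed

end
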